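(* Let $p$ be a prime, $n\ge1$, $H\le\mathcal{H}(p^n)$, and let $S$ be a special generating set for $H$ such that $S^{\dagger}=\{h_1,h_2\}$ with $h_1\neq h_2$. If $h_1$ and $h_2$ do not commute, or $h_2$ commutes properly with $h_1$, then $P(H)/C(H)\cong\mathbb{Z}_p^2$ (the direct product $\mathbb{Z}_p\times\mathbb{Z}_p$).
   Context: For an integer $r\ge 1$, $\mathcal{H}(r)$ denotes the Heisenberg group of $3\times3$ upper unitriangular matrices over $\mathbb{Z}_r=\mathbb{Z}/r\mathbb{Z}$ (trivial if $r=1$). The matrix with $(1,2)$-entry $a_1$, $(1,3)$-entry $a_2$, $(2,3)$-entry $a_3$ is written $a=(a_1,a_2,a_3)$, with $i$th component $a|_i=a_i$; thus $(a_1,a_2,a_3)(b_1,b_2,b_3)=(a_1+b_1,\,a_2+b_2+a_1b_3,\,a_3+b_3)$, and the center is $\{(0,x,0)\}$. Let $q:\mathcal{H}(p^n)\to\mathcal{H}(p^{n-1})$ be the surjective homomorphism reducing each component mod $p^{n-1}$. With $[x,y]=x^{-1}y^{-1}xy$ (so $[a,b]=(0,a_1b_3-a_3b_1,0)$), for $H\le\mathcal{H}(p^n)$ the pseudocentralizer is $P(H)=\{g\in\mathcal{H}(p^n) : [s,g]\in\ker q\text{ for all }s\in H\}$, a subgroup in which the centralizer $C(H)$ is normal. Write $x\sim y$ if $xy^{-1}\in Z(\mathcal{H}(p^n))$, and $S^{\dagger}=S\setminus Z(\mathcal{H}(p^n))$. For non-central $h\in\mathcal{H}(p^n)$, with components viewed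 as integers in $\{0,\dots,p^n-1\}$, write for $i=1,3$: $h|_i=r_ip^{k_i}$ with $0<r_i<p^n$, $p\nmid r_i$, $0\le k_i<n$ if $h|_i\ne0$, and $r_i=0$, $k_i=n$ if $h|_i=0$. Put $\nu(h)=\min\{k_1,k_3\}$, ${}_{\nu}h=(r_1p^{k_1-\nu(h)},0,r_3p^{k_3-\nu(h)})\in\mathcal{H}(p^n)$, and $\nu(S^\dagger)=\min_{h\in S^\dagger}\nu(h)$. A generating set $S$ for $H$ is special if either $S^\dagger=\emptyset$, or there is $h_1\in S^\dagger$ with $\nu(S^\dagger)=\nu(h_1)$ and $h_2\not\sim h_1^w$ for all $h_2\in S^\dagger\setminus\{h_1\}$ and all integers $w\ge 0$. An element $h_2$ is supercommuting with a non-central $h_1$ if $h_2\sim(r_1',0,r_3')^{p^{n-\nu(h_1)}}$ for some $0\le r_1',r_3'<p^{\nu(h_1)}$ with $r_1'+r_3'>0$ (such $r_1',r_3'$ are unique, and such $h_2$ commutes with $h_1$). For an integer $0\le x<p^n$, let $\varphi(x)$ be the $p$-adic valuation of $x$ if $x\neq0$, and $\varphi(0)=n$. For distinct $h_1,h_2\in S^\dagger$ with $\nu(S^\dagger)=\nu(h_1)$, $h_2$ commutes properly with $h_1$ if $h_2$ is supercommuting with $h_1$ and, for the unique integers $0\le r_1',r_3'<p^{\nu(h_1)}$ with $r_1'+r_3'>0$ and $h_2\sim(r_1',0,r_3')^{p^{n-\nu(h_1)}}$, one has $\varphi\bigl([(r_1',0,r_3'),\,{}_{\nu}h_1]|_2\bigr)<\nu(h_1)$.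 *)

theory Defs
  imports "HOL-Algebra.Elementary_Groups" "HOL-Computational_Algebra.Primes"
begin

text \<open>
  The triple \<open>(a\<^sub>1, a\<^sub>2, a\<^sub>3)\<close> of integers in \<open>{0..<r}\<close> stands for the upper unitriangular
  \<open>3 \<times> 3\<close> matrix over \<open>\<int>/r\<int>\<close> whose entries at positions (1,2), (1,3), (2,3) are the residue
  classes of \<open>a\<^sub>1\<close>, \<open>a\<^sub>2\<close>, \<open>a\<^sub>3\<close>; the product below is the matrix product in these coordinates.
\<close>

type_synonym heis_elem = "int \<times> int \<times> int"

fun comp1 :: "heis_elem \<Rightarrow> int" where "comp1 (x, y, z) = x"
fun comp2 :: "heis_elem \<Rightarrow> int" where "comp2 (x, y, z) = y"
fun comp3 :: "heis_elem \<Rightarrow> int" where "comp3 (x, y, z) = z"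

definition heis :: "nat \<Rightarrow> heis_elem monoid" where
  "heis r = \<lparr>carrier = {0..<int r} \<times> {0..<int r} \<times> {0..<int r},
     monoid.mult = (\<lambda>(a1, a2, a3) (b1, b2, b3).
       ((a1 + b1) mod int r, (a2 + b2 + a1 * b3) mod int r, (a3 + b3) mod int r)),
     one = (0, 0, 0)\<rparr>"

definition comm_elem :: "('a, 'b) monoid_scheme \<Rightarrow> 'a \<Rightarrow> 'a \<Rightarrow> 'a" where
  "comm_elem G x y = inv\<^bsub>G\<^esub> x \<otimes>\<^bsub>G\<^esub> inv\<^bsub>G\<^esub> y \<otimes>\<^bsub>G\<^esub> x \<otimes>\<^bsub>G\<^esub> y"

definition centralizer :: "('a, 'b) monoid_scheme \<Rightarrow> 'a set \<Rightarrow> 'a set" where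
  "centralizer G H = {g \<in> carrier G. \<forall>s\<in>H. g \<otimes>\<^bsub>G\<^esub> s = s \<otimes>\<^bsub>G\<^esub> g}"

definition center :: "('a, 'b) monoid_scheme \<Rightarrow> 'a set" where
  "center G = centralizer G (carrier G)"

definition noncentral :: "('a, 'b) monoid_scheme \<Rightarrow> 'a set \<Rightarrow> 'a set" where
  "noncentral G S = S - center G"

definition central_equiv :: "('a, 'b) monoid_scheme \<Rightarrow> 'a \<Rightarrow> 'a \<Rightarrow> bool" where
  "central_equiv G x y \<longleftrightarrow> x \<otimes>\<^bsub>G\<^esub> inv\<^bsub>G\<^esub> y \<in> center G"

text \<open>The reduction homomorphism onto \<open>heis (p ^ (n - 1))\<close>; only used for \<open>n \<ge> 1\<close>.\<close>

definition heis_red :: "nat \<Rightarrow> nat \<Rightarrow> heis_elem \<Rightarrow> heis_elem" where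
  "heis_red p n = (\<lambda>(a1, a2, a3).
     (a1 mod int (p ^ (n - 1)), a2 mod int (p ^ (n - 1)), a3 mod int (p ^ (n - 1))))"

definition pseudocentralizer :: "nat \<Rightarrow> nat \<Rightarrow> heis_elem set \<Rightarrow> heis_elem set" where
  "pseudocentralizer p n H =
     {g \<in> carrier (heis (p ^ n)). \<forall>s\<in>H. comm_elem (heis (p ^ n)) s g
        \<in> kernel (heis (p ^ n)) (heis (p ^ (n - 1))) (heis_red p n)}"

text \<open>
  For \<open>0 \<le> x < p ^ n\<close>, \<open>val p n x\<close> is both \<open>\<phi>(x)\<close> and the exponent \<open>k\<close> in the decomposition
  \<open>x = r * p ^ k\<close> of a component, with \<open>k = n\<close> for \<open>x = 0\<close>; \<open>unit_part p n x\<close> is the factor \<open>r\<close>,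
  with \<open>r = 0\<close> for \<open>x = 0\<close>.
\<close>

definition val :: "nat \<Rightarrow> nat \<Rightarrow> int \<Rightarrow> nat" where
  "val p n x = (if x = 0 then n else multiplicity (int p) x)"

definition unit_part :: "nat \<Rightarrow> nat \<Rightarrow> int \<Rightarrow> int" where
  "unit_part p n x = x div int p ^ val p n x"

definition nu :: "nat \<Rightarrow> nat \<Rightarrow> heis_elem \<Rightarrow> nat" where
  "nu p n h = min (val p n (comp1 h)) (val p n (comp3 h))"

definition nu_reduced :: "nat \<Rightarrow> nat \<Rightarrow> heis_elem \<Rightarrow> heis_elem" where
  "nu_reduced p n h =
     (unit_part p n (comp1 h) * int p ^ (val p n (comp1 h) - nu p n h), 0,
      unit_part p n (comp3 h) * int p ^ (val p n (comp3 h) - nu p n h))"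

definition nu_set :: "nat \<Rightarrow> nat \<Rightarrow> heis_elem set \<Rightarrow> nat" where
  "nu_set p n T = Min (nu p n ` T)"

definition generating_set :: "('a, 'b) monoid_scheme \<Rightarrow> 'a set \<Rightarrow> 'a set \<Rightarrow> bool" where
  "generating_set G S H \<longleftrightarrow> S \<subseteq> carrier G \<and> generate G S = H"

definition special_generating_set ::
    "nat \<Rightarrow> nat \<Rightarrow> heis_elem set \<Rightarrow> heis_elem set \<Rightarrow> bool" where
  "special_generating_set p n S H \<longleftrightarrow>
     generating_set (heis (p ^ n)) S H \<and>
     (noncentral (heis (p ^ n)) S = {} \<or>
      (\<exists>h1 \<in> noncentral (heis (p ^ n)) S.
         nu_set p n (noncentral (heis (p ^ n)) S) = nu p n h1 \<and>
         (\<forall>h2 \<in> noncentral (heis (p ^ n)) S - {h1}. \<forall>w::nat.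
            \<not> central_equiv (heis (p ^ n)) h2 (h1 [^]\<^bsub>heis (p ^ n)\<^esub> w))))"

definition supercommuting_witness ::
    "nat \<Rightarrow> nat \<Rightarrow> heis_elem \<Rightarrow> heis_elem \<Rightarrow> int \<Rightarrow> int \<Rightarrow> bool" where
  "supercommuting_witness p n h1 h2 r1 r3 \<longleftrightarrow>
     0 \<le> r1 \<and> r1 < int p ^ nu p n h1 \<and> 0 \<le> r3 \<and> r3 < int p ^ nu p n h1 \<and> r1 + r3 > 0 \<and>
     central_equiv (heis (p ^ n)) h2 ((r1, 0, r3) [^]\<^bsub>heis (p ^ n)\<^esub> (p ^ (n - nu p n h1)))"

definition supercommuting :: "nat \<Rightarrow> nat \<Rightarrow> heis_elem \<Rightarrow> heis_elem \<Rightarrow> bool" where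
  "supercommuting p n h2 h1 \<longleftrightarrow>
     h1 \<in> noncentral (heis (p ^ n)) (carrier (heis (p ^ n))) \<and> h2 \<in> carrier (heis (p ^ n)) \<and>
     (\<exists>r1 r3. supercommuting_witness p n h1 h2 r1 r3)"

text \<open>
  The notion depends on the ambient generating set \<open>S\<close>, as \<open>h1\<close> has to attain the minimum of \<open>nu\<close>
  on the non-central part of \<open>S\<close>. The pair \<open>(r1, r3)\<close> exists by the supercommuting clause and is
  unique, so the universal quantifier refers to that pair.
\<close>

definition commutes_properly ::
    "nat \<Rightarrow> nat \<Rightarrow> heis_elem set \<Rightarrow> heis_elem \<Rightarrow> heis_elem \<Rightarrow> bool" where
  "commutes_properly p n S h2 h1 \<longleftrightarrow>
     h1 \<in> noncentral (heis (p ^ n)) S \<and> h2 \<in> noncentral (heis (p ^ n)) S \<and> h1 \<noteq> h2 \<and>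
     nu_set p n (noncentral (heis (p ^ n)) S) = nu p n h1 \<and>
     supercommuting p n h2 h1 \<and>
     (\<forall>r1 r3. supercommuting_witness p n h1 h2 r1 r3 \<longrightarrow>
        val p n (comp2 (comm_elem (heis (p ^ n)) (r1, 0, r3) (nu_reduced p n h1))) < nu p n h1)"

lemma heis_inv_aux:
  fixes a b c m :: int
  shows "((a * c - b) mod m + b + (- a) mod m * c) mod m = 0"
proof -
  have "((a * c - b) mod m + b + (- a) mod m * c) mod m = ((a * c - b) + b + (- a) * c) mod m"
    by (intro mod_add_cong) (simp_all only: mod_mod_trivial mod_mult_left_eq)
  then show ?thesis by simp
qed

lemma heis_assoc_aux:
  fixes a b c a' b' c' x y m :: int
  shows "((a + b + x * y) mod m + c + ((x + a') mod m) * b') mod m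
       = (a + (b + c + a' * b') mod m + x * ((y + b') mod m)) mod m"
proof -
  have "((a + b + x * y) mod m + c + ((x + a') mod m) * b') mod m
      = ((a + b + x * y) + c + (x + a') * b') mod m"
    by (intro mod_add_cong) (simp_all only: mod_mod_trivial mod_mult_left_eq)
  also have "\<dots> = (a + (b + c + a' * b') + x * (y + b')) mod m"
    by (simp add: algebra_simps)
  also have "\<dots> = (a + (b + c + a' * b') mod m + x * ((y + b') mod m)) mod m"
    by (intro mod_add_cong) (simp_all only: mod_mod_trivial mod_mult_right_eq)
  finally show ?thesis .
qed

lemma group_heis:
  assumes "r \<ge> 1"
  shows "group (heis r)"
proof (rule groupI)
  fix x assume "x \<in> carrier (heis r)"
  obtain a b c where x: "x = (a, b, c)" by (cases x)
  show "\<exists>y\<in>carrier (heis r). y \<otimes>\<^bsub>heis r\<^esub> x = \<one>\<^bsub>heis r\<^esub>"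
    using assms
    by (intro bexI[of _ "((- a) mod int r, (a * c - b) mod int r, (- c) mod int r)"])
       (auto simp: heis_def x heis_inv_aux mod_simps)
next
  fix x y z
  show "x \<otimes>\<^bsub>heis r\<^esub> y \<otimes>\<^bsub>heis r\<^esub> z = x \<otimes>\<^bsub>heis r\<^esub> (y \<otimes>\<^bsub>heis r\<^esub> z)"
    by (cases x; cases y; cases z)
       (simp only: heis_def monoid.simps prod.case prod.inject heis_assoc_aux,
        simp add: mod_simps add.assoc)
qed (use assms in \<open>auto simp: heis_def\<close>)

lemma inv_heis:
  assumes "r \<ge> 1" "(a, b, c) \<in> carrier (heis r)"
  shows "inv\<^bsub>heis r\<^esub> (a, b, c) = ((- a) mod int r, (a * c - b) mod int r, (- c) mod int r)"
proof -
  interpret group "heis r" using assms(1) by (rule group_heis)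
  show ?thesis
    using assms by (intro inv_equality) (auto simp: heis_def heis_inv_aux mod_simps)
qed

lemma comm_elem_heis:
  assumes "r \<ge> 1" "(a1, a2, a3) \<in> carrier (heis r)" "(b1, b2, b3) \<in> carrier (heis r)"
  shows "comm_elem (heis r) (a1, a2, a3) (b1, b2, b3) = (0, (a1 * b3 - a3 * b1) mod int r, 0)"
proof -
  interpret group "heis r" using assms(1) by (rule group_heis)
  let ?x = "(a1, a2, a3)" and ?y = "(b1, b2, b3)" and ?z = "(0, (a1 * b3 - a3 * b1) mod int r, 0)"
  have z: "?z \<in> carrier (heis r)" using assms(1) by (simp add: heis_def)
  have "?x \<otimes>\<^bsub>heis r\<^esub> ?y = ?y \<otimes>\<^bsub>heis r\<^esub> ?x \<otimes>\<^bsub>heis r\<^esub> ?z"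
    using mod_add_right_eq[of "b2 + a2 + b1 * a3" "a1 * b3 - a3 * b1" "int r"]
    by (simp add: heis_def mod_simps mult.commute add.commute)
  then show ?thesis
    unfolding comm_elem_def using assms(2,3) z
    by (simp add: m_assoc inv_mult_group[symmetric] inv_solve_left')
qed

lemma center_heis:
  assumes "r \<ge> 1"
  shows "center (heis r) = {(0, x, 0) | x. x \<in> {0..<int r}}"
proof (cases "r = 1")
  case True
  then show ?thesis by (auto simp: center_def centralizer_def heis_def)
next
  case False
  then have r: "int r > 1" using assms by simp
  show ?thesis
  proof (intro equalityI subsetI)
    fix g assume g: "g \<in> center (heis r)"
    obtain a b c where abc: "g = (a, b, c)" by (cases g)
    have comm: "g \<otimes>\<^bsub>heis r\<^esub> s = s \<otimes>\<^bsub>heis r\<^esub> g" if "s \<in> carrier (heis r)" for s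
      using g that by (auto simp: center_def centralizer_def)
    have "(1, 0, 0) \<in> carrier (heis r)" "(0, 0, 1) \<in> carrier (heis r)"
      using r by (auto simp: heis_def)
    from this[THEN comm]
    have "b mod int r = (b + c) mod int r" "(b + a) mod int r = b mod int r"
      by (simp_all add: abc heis_def)
    then have "int r dvd c" "int r dvd a"
      by (simp_all add: mod_eq_dvd_iff dvd_diff_commute)
    then show "g \<in> {(0, x, 0) | x. x \<in> {0..<int r}}"
      using g by (auto simp: abc center_def centralizer_def heis_def zdvd_not_zless dest: zdvd_imp_le)
  qed (use r in \<open>auto simp: center_def centralizer_def heis_def algebra_simps\<close>)
qed

lemma pseudocentralizer_iff:
  assumes "prime p" "n \<ge> 1" "H \<subseteq> carrier (heis (p ^ n))"
  shows "(g1, g2, g3) \<in> pseudocentralizer p n H \<longleftrightarrow>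
     (g1, g2, g3) \<in> carrier (heis (p ^ n)) \<and>
     (\<forall>(s1, s2, s3) \<in> H. int (p ^ (n - 1)) dvd s1 * g3 - s3 * g1)"
proof -
  have p: "p ^ n \<ge> 1" "p ^ (n - 1) \<ge> 1" using assms(1) by (auto simp: Suc_le_eq prime_gt_0_nat)
  have d: "int (p ^ (n - 1)) dvd int (p ^ n)"
    by (simp add: le_imp_power_dvd)
  have "comm_elem (heis (p ^ n)) (s1, s2, s3) (g1, g2, g3)
          \<in> kernel (heis (p ^ n)) (heis (p ^ (n - 1))) (heis_red p n)
        \<longleftrightarrow> int (p ^ (n - 1)) dvd s1 * g3 - s3 * g1"
    if "(s1, s2, s3) \<in> H" "(g1, g2, g3) \<in> carrier (heis (p ^ n))" for s1 s2 s3
  proof -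
    have s: "(s1, s2, s3) \<in> carrier (heis (p ^ n))" using that assms by blast
    show ?thesis
      unfolding comm_elem_heis[OF p(1) s that(2)] using p d
      by (simp add: kernel_def heis_red_def heis_def mod_mod_cancel dvd_eq_mod_eq_0
          prime_gt_0_nat[OF assms(1)])
  qed
  then show ?thesis unfolding pseudocentralizer_def by fastforce
qed

lemma subgroup_pseudocentralizer:
  assumes "prime p" "n \<ge> 1" "H \<subseteq> carrier (heis (p ^ n))"
  shows "subgroup (pseudocentralizer p n H) (heis (p ^ n))"
proof -
  have p: "p ^ n \<ge> 1" using assms(1) by (auto simp: Suc_le_eq prime_gt_0_nat)
  interpret group "heis (p ^ n)" using p by (rule group_heis)
  let ?m = "int (p ^ (n - 1))" and ?r = "int (p ^ n)"
  have d: "?m dvd ?r" by (simp add: le_imp_power_dvd)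
  have red: "?m dvd s * (x mod ?r) - t * (y mod ?r) \<longleftrightarrow> ?m dvd s * x - t * y" for s t x y
  proof -
    have "?m dvd x - x mod ?r" for x
      using d by (simp add: minus_mod_eq_mult_div dvd_mult2)
    then have "?m dvd s * (x - x mod ?r) - t * (y - y mod ?r)"
      by (meson dvd_diff dvd_mult)
    moreover have "s * x - t * y
        = s * (x - x mod ?r) - t * (y - y mod ?r) + (s * (x mod ?r) - t * (y mod ?r))"
      by (simp add: algebra_simps)
    ultimately show ?thesis by (simp only: dvd_add_right_iff)
  qed
  note iff = pseudocentralizer_iff[OF assms]
  show ?thesis
  proof (rule subgroupI)
    show "pseudocentralizer p n H \<subseteq> carrier (heis (p ^ n))"
      by (auto simp: pseudocentralizer_def)
    have "\<one>\<^bsub>heis (p ^ n)\<^esub> \<in> pseudocentralizer p n H"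
      using one_closed by (auto simp: heis_def[of "p ^ n"] iff simp del: one_closed)
    then show "pseudocentralizer p n H \<noteq> {}" by blast
  next
    fix g assume g: "g \<in> pseudocentralizer p n H"
    obtain a b c where abc: "g = (a, b, c)" by (cases g)
    have gc: "(a, b, c) \<in> carrier (heis (p ^ n))" using g abc iff by simp
    have "?m dvd s1 * (- c) - s3 * (- a)" if "(s1, s2, s3) \<in> H" for s1 s2 s3
    proof -
      have "?m dvd s1 * c - s3 * a" using g that unfolding abc iff by fast
      then have "?m dvd - (s1 * c - s3 * a)" by (simp only: dvd_minus_iff)
      then show ?thesis by (simp add: algebra_simps)
    qed
    then show "inv\<^bsub>heis (p ^ n)\<^esub> g \<in> pseudocentralizer p n H"
      using inv_closed[OF gc] unfolding abc inv_heis[OF p gc] iff red by blast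
  next
    fix g h assume gh: "g \<in> pseudocentralizer p n H" "h \<in> pseudocentralizer p n H"
    obtain a b c a' b' c' where abc: "g = (a, b, c)" "h = (a', b', c')" by (cases g; cases h)
    have gc: "(a, b, c) \<in> carrier (heis (p ^ n))" "(a', b', c') \<in> carrier (heis (p ^ n))"
      using gh abc iff by simp_all
    have mult: "(a, b, c) \<otimes>\<^bsub>heis (p ^ n)\<^esub> (a', b', c')
        = ((a + a') mod ?r, (b + b' + a * c') mod ?r, (c + c') mod ?r)"
      by (simp add: heis_def)
    have "?m dvd s1 * (c + c') - s3 * (a + a')" if "(s1, s2, s3) \<in> H" for s1 s2 s3
    proof -
      have "?m dvd s1 * c - s3 * a" "?m dvd s1 * c' - s3 * a'"
        using gh that unfolding abc iff by fast+
      then have "?m dvd (s1 * c - s3 * a) + (s1 * c' - s3 * a')" by (rule dvd_add)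
      then show ?thesis by (simp add: algebra_simps)
    qed
    then show "g \<otimes>\<^bsub>heis (p ^ n)\<^esub> h \<in> pseudocentralizer p n H"
      using m_closed[OF gc] unfolding abc mult iff red by blast
  qed
qed

end

theory Submission
  imports Defs
begin

text \<open>
  Commuting in the Heisenberg group is governed by the alternating form \<open>a\<^sub>1 b\<^sub>3 - a\<^sub>3 b\<^sub>1\<close>, so pairing
  with \<open>h\<^sub>1\<close> and \<open>h\<^sub>2\<close> and dividing by \<open>p\<^sup>n\<^sup>-\<^sup>1\<close> maps \<open>P(H)\<close> to \<open>\<int>\<^sub>p\<^sup>2\<close> with kernel \<open>C(H)\<close>. The
  map is onto iff both elementary divisors of the \<open>2 \<times> 2\<close> matrix of non-central components are
  nonzero modulo \<open>p\<^sup>n\<close>. The first is \<open>p\<close> to the minimal \<open>\<nu>\<close>, attained at, say, \<open>h\<^sub>1\<close>; the second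
  vanishes only if \<open>h\<^sub>2\<close> is a multiple of \<open>h\<^sub>1\<close>, which a special generating set excludes.
\<close>

section \<open>Commutator form on the Heisenberg group\<close>

text \<open>Kept as an unreduced integer, so that divisibility by \<open>p ^ (n - 1)\<close> and by
  \<open>p ^ n\<close> can be read off the same number.\<close>

definition comm_form :: "heis_elem \<Rightarrow> heis_elem \<Rightarrow> int" where
  "comm_form s g = comp1 s * comp3 g - comp3 s * comp1 g"

lemma comm_form_swap: "comm_form s g = - comm_form g s"
  by (simp add: comm_form_def)

lemma comp_mult_heis:
  "comp1 (x \<otimes>\<^bsub>heis r\<^esub> y) = (comp1 x + comp1 y) mod int r"
  "comp3 (x \<otimes>\<^bsub>heis r\<^esub> y) = (comp3 x + comp3 y) mod int r"
  by (cases x; cases y; simp add: heis_def)+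

lemma comp_pow_heis:
  "comp1 (x [^]\<^bsub>heis r\<^esub> (w::nat)) = (int w * comp1 x) mod int r"
  "comp3 (x [^]\<^bsub>heis r\<^esub> (w::nat)) = (int w * comp3 x) mod int r"
proof (induction w)
  case 0
  { case 1 show ?case by (simp add: nat_pow_def heis_def) }
  { case 2 show ?case by (simp add: nat_pow_def heis_def) }
next
  case (Suc w)
  have S: "x [^]\<^bsub>heis r\<^esub> Suc w = x [^]\<^bsub>heis r\<^esub> w \<otimes>\<^bsub>heis r\<^esub> x"
    by (simp add: nat_pow_def)
  { case 1 show ?case unfolding S comp_mult_heis Suc mod_add_left_eq by (simp add: distrib_right add.commute) }
  { case 2 show ?case unfolding S comp_mult_heis Suc mod_add_left_eq by (simp add: distrib_right add.commute) }
qed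

text \<open>Additivity holds only up to multiples of \<open>r\<close>, since products reduce their
  components modulo \<open>r\<close> while the form is integer-valued.\<close>

lemma comm_form_mult_heis: "int r dvd comm_form (x \<otimes>\<^bsub>heis r\<^esub> y) g - (comm_form x g + comm_form y g)"
proof -
  have "comm_form (x \<otimes>\<^bsub>heis r\<^esub> y) g - (comm_form x g + comm_form y g)
      = int r * (((comp3 x + comp3 y) div int r) * comp1 g
                  - ((comp1 x + comp1 y) div int r) * comp3 g)"
    unfolding comm_form_def comp_mult_heis minus_mult_div_eq_mod[symmetric]
    by (simp add: algebra_simps)
  then show ?thesis by simp
qed

lemma comm_form_one_heis [simp]: "comm_form \<one>\<^bsub>heis r\<^esub> g = 0"
  by (simp add: comm_form_def heis_def)

text \<open>As \<open>m\<close> divides \<open>r\<close>, the elements pairing with \<open>g\<close>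
  to a multiple of \<open>m\<close> are closed under products and inverses. The cases
  \<open>m = p ^ n\<close> and \<open>m = p ^ (n - 1)\<close> serve the centralizer and the
  pseudocentralizer.\<close>

lemma dvd_comm_form_generate:
  assumes r: "r \<ge> 1" and m: "m dvd int r" and S: "S \<subseteq> carrier (heis r)"
    and gen: "\<And>t. t \<in> S \<Longrightarrow> m dvd comm_form t g"
    and s: "s \<in> generate (heis r) S"
  shows "m dvd comm_form s g"
proof -
  interpret group "heis r" using r by (rule group_heis)
  have mult: "m dvd comm_form (x \<otimes>\<^bsub>heis r\<^esub> y) g \<longleftrightarrow> m dvd comm_form x g + comm_form y g" for x y
    using dvd_trans[OF m comm_form_mult_heis[of r x y g]]
    by (metis diff_add_cancel dvd_add_right_iff)
  show ?thesis
    using s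
  proof (induction rule: generate.induct)
    case one
    then show ?case by simp
  next
    case (incl h)
    then show ?case by (rule gen)
  next
    case (inv h)
    have "inv\<^bsub>heis r\<^esub> h \<otimes>\<^bsub>heis r\<^esub> h = \<one>\<^bsub>heis r\<^esub>" using inv S by (auto intro: l_inv)
    with mult[of "inv\<^bsub>heis r\<^esub> h" h] gen[OF inv] show ?case
      by (metis dvd_0_right dvd_add_left_iff comm_form_one_heis)
  next
    case (eng x y)
    then show ?case by (simp add: mult)
  qed
qed

lemma commute_heis_iff:
  assumes "r \<ge> 1" "s \<in> carrier (heis r)" "g \<in> carrier (heis r)"
  shows "g \<otimes>\<^bsub>heis r\<^esub> s = s \<otimes>\<^bsub>heis r\<^esub> g \<longleftrightarrow> int r dvd comm_form s g"
proof -
  obtain s1 s2 s3 g1 g2 g3 where e: "s = (s1, s2, s3)" "g = (g1, g2, g3)"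
    by (cases s; cases g)
  have "g \<otimes>\<^bsub>heis r\<^esub> s = s \<otimes>\<^bsub>heis r\<^esub> g \<longleftrightarrow>
      int r dvd (s2 + g2 + s1 * g3) - (g2 + s2 + g1 * s3)"
    unfolding e mod_eq_dvd_iff[symmetric] by (auto simp: heis_def add.commute)
  then show ?thesis by (simp add: e comm_form_def mult.commute)
qed

section \<open>Centralizer and pseudocentralizer in terms of generators\<close>

lemma centralizer_heis_generate:
  assumes r: "r \<ge> 1" and S: "S \<subseteq> carrier (heis r)"
  shows "centralizer (heis r) (generate (heis r) S)
       = {g \<in> carrier (heis r). \<forall>s\<in>S. int r dvd comm_form s g}"
proof -
  interpret group "heis r" using r by (rule group_heis)
  have "generate (heis r) S \<subseteq> carrier (heis r)" using S by (rule generate_incl)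
  then have "centralizer (heis r) (generate (heis r) S)
      = {g \<in> carrier (heis r). \<forall>s\<in>generate (heis r) S. int r dvd comm_form s g}"
    unfolding centralizer_def using commute_heis_iff[OF r] by (intro Collect_cong) (meson subsetD)
  also have "\<dots> = {g \<in> carrier (heis r). \<forall>s\<in>S. int r dvd comm_form s g}"
    by (intro Collect_cong conj_cong refl iffI ballI)
       (auto intro: generate.incl dvd_comm_form_generate[OF r dvd_refl S])
  finally show ?thesis .
qed

lemma pseudocentralizer_generate:
  assumes p: "prime p" and n: "n \<ge> 1" and S: "S \<subseteq> carrier (heis (p ^ n))"
  shows "pseudocentralizer p n (generate (heis (p ^ n)) S)
       = {g \<in> carrier (heis (p ^ n)). \<forall>s\<in>S. int p ^ (n - 1) dvd comm_form s g}"
proof -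
  have r: "p ^ n \<ge> 1" using p by (auto simp: Suc_le_eq prime_gt_0_nat)
  interpret group "heis (p ^ n)" using r by (rule group_heis)
  have G: "generate (heis (p ^ n)) S \<subseteq> carrier (heis (p ^ n))" using S by (rule generate_incl)
  have m: "int p ^ (n - 1) dvd int (p ^ n)" by (simp add: le_imp_power_dvd)
  have "pseudocentralizer p n (generate (heis (p ^ n)) S)
      = {g \<in> carrier (heis (p ^ n)). \<forall>s\<in>generate (heis (p ^ n)) S. int p ^ (n - 1) dvd comm_form s g}"
  proof (rule Set.set_eqI)
    fix g :: heis_elem
    obtain g1 g2 g3 where g: "g = (g1, g2, g3)" by (cases g)
    show "g \<in> pseudocentralizer p n (generate (heis (p ^ n)) S) \<longleftrightarrow>
      g \<in> {g \<in> carrier (heis (p ^ n)). \<forall>s\<in>generate (heis (p ^ n)) S. int p ^ (n - 1) dvd comm_form s g}"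
      unfolding g pseudocentralizer_iff[OF p n G] mem_Collect_eq
      by (intro conj_cong refl ball_cong) (simp add: comm_form_def split: prod.split)
  qed
  also have "\<dots> = {g \<in> carrier (heis (p ^ n)). \<forall>s\<in>S. int p ^ (n - 1) dvd comm_form s g}"
    by (intro Collect_cong conj_cong refl iffI ballI)
       (auto intro: generate.incl dvd_comm_form_generate[OF r m S] simp del: One_nat_def)
  finally show ?thesis .
qed

lemma comm_form_center_heis:
  assumes "r \<ge> 1" "s \<in> center (heis r)"
  shows "comm_form s g = 0"
  using assms by (auto simp: center_heis comm_form_def)

lemma central_equiv_heisI:
  assumes r: "r \<ge> 1" and "x \<in> carrier (heis r)" "y \<in> carrier (heis r)"
    and "comp1 x = comp1 y" "comp3 x = comp3 y"
  shows "central_equiv (heis r) x y"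
proof -
  obtain a b c b' where e: "x = (a, b, c)" "y = (a, b', c)"
    using assms(4,5) by (cases x; cases y) auto
  then show ?thesis
    using assms by (simp add: central_equiv_def center_heis inv_heis) (simp add: heis_def mod_simps)
qed

section \<open>Linear systems modulo a prime power\<close>

text \<open>One of \<open>u\<close>, \<open>v\<close> is invertible modulo \<open>p ^ n\<close>; its
  inverse and coefficient 0 for the other do the job.\<close>

lemma prime_power_bezout:
  fixes u v p :: int
  assumes "prime p" "\<not> (p dvd u \<and> p dvd v)"
  shows "\<exists>x y. p ^ n dvd x * u + y * v - 1"
proof -
  have *: "\<exists>x. p ^ n dvd x * t - 1" if "\<not> p dvd t" for t
  proof -
    have "coprime t (p ^ n)"
      using that assms(1) by (simp add: prime_imp_coprime coprime_commute)
    then obtain x y where "x * t + y * p ^ n = 1"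
      by (metis bezout_int coprime_iff_gcd_eq_1)
    then have "x * t - 1 = p ^ n * (- y)" by (simp add: algebra_simps)
    then show ?thesis by (metis dvd_triv_left)
  qed
  from assms(2) consider "\<not> p dvd u" | "\<not> p dvd v" by blast
  then show ?thesis
  proof cases
    case 1
    then obtain x where "p ^ n dvd x * u + 0 * v - 1" using * by auto
    then show ?thesis by blast
  next
    case 2
    then obtain y where "p ^ n dvd 0 * u + y * v - 1" using * by auto
    then show ?thesis by blast
  qed
qed

text \<open>
  With \<open>(a1, a3) = p\<^sup>k (u1, u3)\<close> and \<open>x u1 + y u3 \<equiv> 1\<close>, the vectors \<open>(-y, x)\<close> and \<open>(u1, u3)\<close> form a
  basis modulo \<open>p\<^sup>n\<close> in which the system becomes triangular, with diagonal \<open>p\<^sup>k\<close> and \<open>d\<close>. Either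
  \<open>d\<close> vanishes modulo \<open>p\<^sup>n\<close>, and \<open>b\<close> is a multiple of \<open>a\<close>, or both diagonal entries divide
  \<open>p\<^sup>n\<^sup>-\<^sup>1\<close> up to a unit.
\<close>

lemma prime_power_system:
  fixes a1 a3 b1 b3 s t p :: int
  assumes p: "prime p" and k: "k < n"
    and dvd: "p ^ k dvd a1" "p ^ k dvd a3" "p ^ k dvd b1" "p ^ k dvd b3"
    and prim: "\<not> (p ^ Suc k dvd a1 \<and> p ^ Suc k dvd a3)"
    and indep: "\<nexists>c. p ^ n dvd b1 - c * a1 \<and> p ^ n dvd b3 - c * a3"
  shows "\<exists>g1 g3. p ^ n dvd a1 * g3 - a3 * g1 - p ^ (n - 1) * s
               \<and> p ^ n dvd b1 * g3 - b3 * g1 - p ^ (n - 1) * t"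
proof -
  obtain u1 u3 w1 w3 where e: "a1 = p ^ k * u1" "a3 = p ^ k * u3" "b1 = p ^ k * w1" "b3 = p ^ k * w3"
    using dvd by (auto elim!: dvdE)
  have "\<not> (p dvd u1 \<and> p dvd u3)"
    using prim unfolding e by (auto simp: mult.commute intro: mult_dvd_mono)
  from prime_power_bezout[OF p this, of n]
  obtain x y f where "x * u1 + y * u3 - 1 = p ^ n * f" by (auto elim!: dvdE)
  then have f: "x * u1 = 1 - y * u3 + p ^ n * f" by simp
  define c where "c = x * w1 + y * w3"
  define d where "d = p ^ k * (u1 * w3 - u3 * w1)"
  have "\<not> p ^ n dvd d"
  proof
    assume "p ^ n dvd d"
    then obtain d' where d': "d = p ^ n * d'" by (elim dvdE)
    \<comment> \<open>The vector \<open>b - c * a\<close> equals \<open>d * (-y, x)\<close> plus a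
      multiple of the Bezout error \<open>1 - x * u1 - y * u3\<close>, which \<open>p ^ n\<close>
      divides.\<close>
    have "b1 - c * a1 = - y * d + p ^ k * w1 * (1 - y * u3 - x * u1)"
      unfolding c_def d_def e by algebra
    also have "\<dots> = p ^ n * (- y * d' - b1 * f)"
      unfolding f d' e by (simp add: algebra_simps)
    finally have 1: "p ^ n dvd b1 - c * a1" by simp
    have "b3 - c * a3 = x * d + p ^ k * w3 * (1 - y * u3 - x * u1)"
      unfolding c_def d_def e by algebra
    also have "\<dots> = p ^ n * (x * d' - b3 * f)"
      unfolding f d' e by (simp add: algebra_simps)
    finally have "p ^ n dvd b3 - c * a3" by simp
    with 1 indep show False by blast
  qed
  define j where "j = multiplicity p d"
  have d0: "d \<noteq> 0" using \<open>\<not> p ^ n dvd d\<close> by auto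
  have j: "j < n" using \<open>\<not> p ^ n dvd d\<close> d0 p
    by (metis j_def multiplicity_dvd' not_less)
  obtain q where q: "d = p ^ j * q" "\<not> p dvd q"
    using d0 p unfolding j_def by (metis multiplicity_decompose' not_prime_unit)
  \<comment> \<open>An inverse of \<open>q\<close> modulo \<open>p\<close> suffices, because
    \<open>be * d\<close> carries the factor \<open>p ^ (n - 1)\<close>.\<close>
  obtain z h where z: "z * q = 1 + p * h"
    using prime_power_bezout[OF p, of q 0 1] q(2)
    by (auto elim!: dvdE simp: algebra_simps)
  \<comment> \<open>Back substitution: \<open>al\<close> solves the first equation
    \<open>p ^ k * al = p ^ (n - 1) * s\<close>, and then \<open>be\<close> solves
    \<open>p ^ k * al * c - be * d = p ^ (n - 1) * t\<close> modulo \<open>p ^ n\<close>. The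
    exponents do not truncate, as \<open>k < n\<close> and \<open>j < n\<close>.\<close>
  define al where "al = p ^ (n - 1 - k) * s"
  define be where "be = p ^ (n - 1 - j) * ((s * c - t) * z)"
  have al: "p ^ k * al = p ^ (n - 1) * s"
    using k unfolding al_def mult.assoc[symmetric] power_add[symmetric] by simp
  have be: "be * d = p ^ (n - 1) * ((s * c - t) * (1 + p * h))"
  proof -
    have "be * d = (p ^ (n - 1 - j) * p ^ j) * ((s * c - t) * (z * q))"
      unfolding be_def q(1) by algebra
    then show ?thesis using j unfolding z power_add[symmetric] by simp
  qed
  have pn: "p ^ n = p * p ^ (n - 1)" using k by (cases n) auto
  define g1 g3 where "g1 = - al * y + be * u1" and "g3 = al * x + be * u3"
  have "a1 * g3 - a3 * g1 = p ^ k * al * (x * u1 + y * u3)"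
    unfolding e g1_def g3_def by algebra
  also have "\<dots> = p ^ (n - 1) * s * (1 + p ^ n * f)" unfolding al f by simp
  finally have "a1 * g3 - a3 * g1 - p ^ (n - 1) * s = p ^ n * (p ^ (n - 1) * s * f)"
    by (simp add: algebra_simps)
  moreover have "b1 * g3 - b3 * g1 = (p ^ k * al) * c - be * d"
    unfolding e g1_def g3_def c_def d_def by algebra
  then have "b1 * g3 - b3 * g1 - p ^ (n - 1) * t = p ^ n * (- (s * c - t) * h)"
    unfolding al be pn by (simp add: algebra_simps)
  ultimately show ?thesis by (metis dvd_triv_left)
qed

section \<open>Valuations of noncentral elements\<close>

lemma nu_power_dvd:
  assumes "k \<le> nu p n h"
  shows "int p ^ k dvd comp1 h" "int p ^ k dvd comp3 h"
  using assms by (auto simp: nu_def val_def multiplicity_dvd' split: if_splits)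

text \<open>A noncentral element has a nonzero first or third component \<open>x\<close>, and
  \<open>0 < x < p ^ n\<close> forces valuation below \<open>n\<close>; so the value
  \<open>n\<close> assigned to 0 is never the minimum.\<close>

lemma nu_noncentral:
  assumes p: "prime p" and h: "h \<in> carrier (heis (p ^ n))" "h \<notin> center (heis (p ^ n))"
  shows "nu p n h < n"
    and "\<not> (int p ^ Suc (nu p n h) dvd comp1 h \<and> int p ^ Suc (nu p n h) dvd comp3 h)"
proof -
  have r: "p ^ n \<ge> 1" using p by (auto simp: Suc_le_eq prime_gt_0_nat)
  obtain a b c where e: "h = (a, b, c)" by (cases h)
  have bd: "0 \<le> a" "a < int p ^ n" "0 \<le> c" "c < int p ^ n" and nz: "a \<noteq> 0 \<or> c \<noteq> 0"
    using h unfolding e center_heis[OF r] by (auto simp: heis_def)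
  have val: "val p n x < n" if "0 < x" "x < int p ^ n" for x
  proof (rule ccontr)
    assume "\<not> val p n x < n"
    then have "int p ^ n dvd x" using that by (auto simp: val_def intro: multiplicity_dvd')
    then show False using that by (auto dest: zdvd_imp_le)
  qed
  have not_dvd: "\<not> int p ^ Suc (val p n x) dvd x" if "x \<noteq> 0" for x
  proof -
    have "\<not> is_unit (int p)" using p by (auto simp: prime_gt_1_nat zdvd1_eq)
    then show ?thesis
      using that multiplicity_geI[of x "int p" "Suc (multiplicity (int p) x)"] by (force simp: val_def)
  qed
  show lt: "nu p n h < n"
    using nz val[of a] val[of c] bd by (auto simp: nu_def e min_less_iff_disj)
  show "\<not> (int p ^ Suc (nu p n h) dvd comp1 h \<and> int p ^ Suc (nu p n h) dvd comp3 h)"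
    using lt not_dvd[of a] not_dvd[of c] by (auto simp: nu_def e min_def val_def split: if_splits)
qed

section \<open>The quotient as an image in the product of two cyclic groups\<close>

text \<open>The failure of additivity is a multiple of \<open>p ^ n\<close>, hence of
  \<open>p\<close> after division by \<open>p ^ (n - 1)\<close>.\<close>

lemma comm_form_mult_div_mod:
  assumes p: "p > 0" and n: "n \<ge> 1"
    and m: "int p ^ (n - 1) dvd comm_form a x" "int p ^ (n - 1) dvd comm_form a y"
  shows "comm_form a (x \<otimes>\<^bsub>heis (p ^ n)\<^esub> y) div int p ^ (n - 1) mod int p
       = (comm_form a x div int p ^ (n - 1) mod int p + comm_form a y div int p ^ (n - 1) mod int p) mod int p"
proof -
  let ?m = "int p ^ (n - 1)"
  have pn: "int (p ^ n) = ?m * int p" using n by (cases n) auto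
  obtain k where "comm_form (x \<otimes>\<^bsub>heis (p ^ n)\<^esub> y) a - (comm_form x a + comm_form y a) = int (p ^ n) * k"
    using comm_form_mult_heis by (metis dvdE)
  then have k: "comm_form a (x \<otimes>\<^bsub>heis (p ^ n)\<^esub> y) = comm_form a x + comm_form a y - ?m * (int p * k)"
    unfolding pn comm_form_swap[of a] by (simp add: algebra_simps)
  from m obtain i j where ij: "comm_form a x = ?m * i" "comm_form a y = ?m * j" by (auto elim!: dvdE)
  have "comm_form a (x \<otimes>\<^bsub>heis (p ^ n)\<^esub> y) = ?m * (i + j - int p * k)"
    unfolding k ij by (simp add: algebra_simps)
  moreover have "(i + j - int p * k) mod int p = (i + j) mod int p"
    by (simp add: mod_eq_dvd_iff)
  ultimately show ?thesis using p by (simp add: ij mod_simps)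
qed

text \<open>First isomorphism theorem for the pair of rescaled pairings. Middle component 0 in
  \<open>surj\<close> loses nothing, as the form ignores it.\<close>

lemma pseudocentralizer_quotient_iso:
  assumes p: "prime p" and n: "n \<ge> 1" and S: "S \<subseteq> carrier (heis (p ^ n))"
    and ab: "noncentral (heis (p ^ n)) S = {a, b}"
    and surj: "\<And>s t. \<exists>g1 g3. int p ^ n dvd comm_form a (g1, 0, g3) - int p ^ (n - 1) * s
                          \<and> int p ^ n dvd comm_form b (g1, 0, g3) - int p ^ (n - 1) * t"
  shows "(heis (p ^ n))\<lparr>carrier := pseudocentralizer p n (generate (heis (p ^ n)) S)\<rparr>
           Mod centralizer (heis (p ^ n)) (generate (heis (p ^ n)) S)
         \<cong> integer_mod_group p \<times>\<times> integer_mod_group p"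
proof -
  have r: "p ^ n \<ge> 1" and p0: "p > 0" using p by (auto simp: Suc_le_eq prime_gt_0_nat)
  interpret group "heis (p ^ n)" using r by (rule group_heis)
  let ?m = "int p ^ (n - 1)" and ?H = "generate (heis (p ^ n)) S"
  let ?P = "pseudocentralizer p n ?H" and ?C = "centralizer (heis (p ^ n)) ?H"
  let ?G = "(heis (p ^ n))\<lparr>carrier := ?P\<rparr>" and ?Z = "integer_mod_group p \<times>\<times> integer_mod_group p"
  have pn: "int p ^ n = ?m * int p" using n by (cases n) auto
  have m0: "?m > 0" using p0 by simp
  \<comment> \<open>Central generators pair to 0 with everything, so only \<open>a\<close> and
    \<open>b\<close> impose conditions.\<close>
  have all: "(\<forall>s\<in>S. k dvd comm_form s g) \<longleftrightarrow> k dvd comm_form a g \<and> k dvd comm_form b g" for k g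
  proof -
    have "S \<subseteq> {a, b} \<union> center (heis (p ^ n))" "{a, b} \<subseteq> S"
      using ab by (auto simp: noncentral_def)
    moreover have "k dvd comm_form s g" if "s \<in> center (heis (p ^ n))" for s
      using comm_form_center_heis[OF r that, of g] by simp
    ultimately show ?thesis by blast
  qed
  have P: "?P = {g \<in> carrier (heis (p ^ n)). ?m dvd comm_form a g \<and> ?m dvd comm_form b g}"
    unfolding pseudocentralizer_generate[OF p n S] all ..
  have C: "?C = {g \<in> carrier (heis (p ^ n)). int p ^ n dvd comm_form a g \<and> int p ^ n dvd comm_form b g}"
    unfolding centralizer_heis_generate[OF r S] all by simp
  have "subgroup ?P (heis (p ^ n))"
    using generate_incl[OF S] by (rule subgroup_pseudocentralizer[OF p n])
  then have G: "group ?G" by (rule subgroup_imp_group)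
  have Z: "group ?Z" by (simp add: DirProd_group)
  define F where "F g = (comm_form a g div ?m mod int p, comm_form b g div ?m mod int p)" for g
  have "F \<in> hom ?G ?Z"
  proof (rule homI)
    show "F x \<in> carrier ?Z" for x
      using p0 by (simp add: F_def carrier_integer_mod_group)
    fix x y assume "x \<in> carrier ?G" "y \<in> carrier ?G"
    then have "?m dvd comm_form a x" "?m dvd comm_form a y" "?m dvd comm_form b x" "?m dvd comm_form b y"
      unfolding P by simp_all
    then show "F (x \<otimes>\<^bsub>?G\<^esub> y) = F x \<otimes>\<^bsub>?Z\<^esub> F y"
      by (simp add: F_def comm_form_mult_div_mod[OF p0 n] del: One_nat_def)
  qed
  then interpret F: group_hom ?G ?Z F
    using G Z by (simp add: group_hom_def group_hom_axioms_def)
  have "kernel ?G ?Z F = ?C"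
  proof -
    have "?m dvd x \<and> x div ?m mod int p = 0 \<longleftrightarrow> int p ^ n dvd x" for x
    proof -
      have "?m * int p dvd x \<longleftrightarrow> int p dvd x div ?m" if "?m dvd x"
        using that m0 by (elim dvdE) simp
      then show ?thesis unfolding pn mod_eq_0_iff_dvd using dvd_mult_left by blast
    qed
    note this[symmetric]
    then show ?thesis unfolding kernel_def C P F_def
      by (simp del: One_nat_def) blast
  qed
  moreover have "F ` carrier ?G = carrier ?Z"
  proof
    show "F ` carrier ?G \<subseteq> carrier ?Z" using F.hom_closed by blast
    show "carrier ?Z \<subseteq> F ` carrier ?G"
    proof
      fix z assume "z \<in> carrier ?Z"
      then obtain s t where z: "z = (s, t)" and st: "s mod int p = s" "t mod int p = t"
        using p0 by (auto simp: carrier_integer_mod_group)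
      obtain g1 g3 where g: "int p ^ n dvd comm_form a (g1, 0, g3) - ?m * s"
          "int p ^ n dvd comm_form b (g1, 0, g3) - ?m * t"
        using surj by blast
      \<comment> \<open>Reducing the integer solution into the carrier changes each pairing by a
        multiple of \<open>p ^ n\<close>.\<close>
      define g' where "g' = (g1 mod int p ^ n, 0::int, g3 mod int p ^ n)"
      have g'c: "g' \<in> carrier (heis (p ^ n))" using p0 by (simp add: g'_def heis_def)
      have main: "?m dvd comm_form x g' \<and> comm_form x g' div ?m mod int p = v"
        if "int p ^ n dvd comm_form x (g1, 0, g3) - ?m * v" "v mod int p = v" for x v
      proof -
        have "comm_form x (g1, 0, g3) - comm_form x g'
            = int p ^ n * (comp1 x * (g3 div int p ^ n) - comp3 x * (g1 div int p ^ n))"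
          unfolding g'_def minus_mult_div_eq_mod[symmetric] by (simp add: comm_form_def algebra_simps)
        then have "int p ^ n dvd comm_form x (g1, 0, g3) - comm_form x g'" by simp
        from dvd_diff[OF that(1) this] have "int p ^ n dvd comm_form x g' - ?m * v" by simp
        then obtain k where "comm_form x g' - ?m * v = int p ^ n * k" by (elim dvdE)
        then have "comm_form x g' = ?m * (v + int p * k)" by (simp add: pn algebra_simps)
        then show ?thesis using p0 that(2) by simp
      qed
      have "g' \<in> carrier ?G" "F g' = z"
        using main[OF g(1) st(1)] main[OF g(2) st(2)] g'c by (simp_all add: P F_def z)
      then show "z \<in> F ` carrier ?G" by blast
    qed
  qed
  ultimately show ?thesis using F.FactGroup_iso by simp
qed

section \<open>Surjectivity from the special generating set\<close>

text \<open>Powers multiply the outer components by the exponent, so up to the center "power of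
  \<open>a\<close>" means "multiple of \<open>a\<close>", which \<open>indep\<close> rules out for
  \<open>b\<close>.\<close>

lemma comm_form_system_solvable:
  assumes p: "prime p"
    and a: "a \<in> carrier (heis (p ^ n))" "a \<notin> center (heis (p ^ n))"
    and b: "b \<in> carrier (heis (p ^ n))"
    and le: "nu p n a \<le> nu p n b"
    and indep: "\<And>w::nat. \<not> central_equiv (heis (p ^ n)) b (a [^]\<^bsub>heis (p ^ n)\<^esub> w)"
  shows "\<exists>g1 g3. int p ^ n dvd comm_form a (g1, 0, g3) - int p ^ (n - 1) * s
               \<and> int p ^ n dvd comm_form b (g1, 0, g3) - int p ^ (n - 1) * t"
proof -
  have r: "p ^ n \<ge> 1" using p by (auto simp: Suc_le_eq prime_gt_0_nat)
  then have r0: "int p ^ n > 0" using p by (simp add: prime_gt_0_nat)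
  interpret group "heis (p ^ n)" using r by (rule group_heis)
  have bd: "comp1 b mod int p ^ n = comp1 b" "comp3 b mod int p ^ n = comp3 b"
    using b by (cases b; simp add: heis_def)+
  have "\<nexists>c. int p ^ n dvd comp1 b - c * comp1 a \<and> int p ^ n dvd comp3 b - c * comp3 a"
  proof
    assume "\<exists>c. int p ^ n dvd comp1 b - c * comp1 a \<and> int p ^ n dvd comp3 b - c * comp3 a"
    then obtain c where c: "comp1 b = c * comp1 a mod int p ^ n" "comp3 b = c * comp3 a mod int p ^ n"
      unfolding mod_eq_dvd_iff[symmetric] bd by blast
    \<comment> \<open>The exponents in \<open>indep\<close> are natural numbers, so the integer
      \<open>c\<close> is replaced by its residue modulo \<open>p ^ n\<close>.\<close>
    define w where "w = nat (c mod int p ^ n)"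
    have w: "int w = c mod int p ^ n" using r0 by (simp add: w_def)
    have "central_equiv (heis (p ^ n)) b (a [^]\<^bsub>heis (p ^ n)\<^esub> w)"
      using r b a c by (intro central_equiv_heisI) (auto simp: comp_pow_heis w mod_mult_left_eq)
    with indep show False by blast
  qed
  from prime_power_system[OF _ nu_noncentral(1)[OF p a] nu_power_dvd[OF order_refl]
      nu_power_dvd[OF le] nu_noncentral(2)[OF p a] this]
  show ?thesis using p by (simp add: comm_form_def)
qed

theorem theorem5p39:
  fixes p n :: nat and H S :: "heis_elem set" and h1 h2 :: heis_elem
  assumes "prime p" and "n \<ge> 1"
    and "subgroup H (heis (p ^ n))"
    and "special_generating_set p n S H"
    and "noncentral (heis (p ^ n)) S = {h1, h2}" and "h1 \<noteq> h2"
    and "h1 \<otimes>\<^bsub>heis (p ^ n)\<^esub> h2 \<noteq> h2 \<otimes>\<^bsub>heis (p ^ n)\<^esub> h1 \<or> commutes_properly p n S h2 h1"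
  shows "(heis (p ^ n))\<lparr>carrier := pseudocentralizer p n H\<rparr> Mod centralizer (heis (p ^ n)) H
           \<cong> integer_mod_group p \<times>\<times> integer_mod_group p"
proof -
  have S: "S \<subseteq> carrier (heis (p ^ n))" and H: "generate (heis (p ^ n)) S = H"
    using assms(4) by (auto simp: special_generating_set_def generating_set_def)
  \<comment> \<open>The distinguished generator may be \<open>h1\<close> or \<open>h2\<close>; it is
    called \<open>a\<close> and the other one \<open>b\<close>.\<close>
  obtain a where a: "a \<in> {h1, h2}" "nu_set p n {h1, h2} = nu p n a"
    and indep: "\<And>b w. b \<in> {h1, h2} - {a} \<Longrightarrow>
      \<not> central_equiv (heis (p ^ n)) b (a [^]\<^bsub>heis (p ^ n)\<^esub> (w::nat))"
    using assms(4) unfolding special_generating_set_def assms(5) by blast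
  obtain b where b: "{h1, h2} = {a, b}" "b \<in> {h1, h2} - {a}"
    using a(1) assms(6) by blast
  have ab: "noncentral (heis (p ^ n)) S = {a, b}" using assms(5) b(1) by simp
  then have mem: "a \<in> carrier (heis (p ^ n))" "a \<notin> center (heis (p ^ n))" "b \<in> carrier (heis (p ^ n))"
    using S by (auto simp: noncentral_def)
  have "nu p n a \<le> nu p n b"
    using a(2) unfolding b(1) nu_set_def by (simp add: min_def split: if_splits)
  from comm_form_system_solvable[OF assms(1) mem this indep[OF b(2)]]
  show ?thesis using pseudocentralizer_quotient_iso[OF assms(1,2) S ab] unfolding H by blast
qed

end
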